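(* Let $\mathcal{D}$ be a fixed finite dataset of observations that are i.i.d. conditionally on a parameter $\boldsymbol{\theta}\in\mathbb{R}^{n_\theta}$, and let $p(\boldsymbol{\theta})$ be a prior probability density of $\boldsymbol{\theta}$; the prior and the likelihood may belong to arbitrary distribution families. For an integer $M\geq 1$, suppose $\mathcal{D}$ is split among $M$ agents into mutually exclusive sets $\mathcal{D}=\{\mathcal{D}_1,\dots,\mathcal{D}_M\}$, all agents using the same prior $p(\boldsymbol{\theta})$. Let $p(\boldsymbol{\theta}|\mathcal{D})$ be the CIL fused posterior and let $\widetilde p(\boldsymbol{\theta}|\mathcal{D})=\widetilde p_M(\boldsymbol{\theta}|\mathcal{D})$ be the CIP fused posterior obtained from these $M$ agents (both defined in the context). Let $d_M\left(p(\boldsymbol{\theta}|\mathcal{D})\parallel\widetilde p(\boldsymbol{\theta}|\mathcal{D})\right)$ denote either the Kullback-Leibler divergence or the $\chi^2$ divergence of $p(\boldsymbol{\theta}|\mathcal{D})$ from $\widetilde p_M(\boldsymbol{\theta}|\mathcal{D})$, with values in $[0,\infty]$. Then the divergence is nondecreasing in the number of agents: for every integer $M\geq 1$, when the same dataset $\mathcal{D}$ is split among $M$ agents and among $M+1$ agents respectively, $$d_{M+1}\left(p(\boldsymbol{\theta}|\mathcal{D})\parallel\widetilde p(\boldsymbol{\theta}|\mathcal{D})\right)\;\geq\; d_M\left(p(\boldsymbol{\theta}|\mathcal{D})\parallel\widetilde p(\boldsymbol{\theta}|\mathcal{D})\right),$$ both when $d$ is the Kullback-Leibler divergence and when $d$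 is the $\chi^2$ divergence.
   Context: All distributions of $\boldsymbol{\theta}$ are given by densities on $\mathbb{R}^{n_\theta}$ with respect to Lebesgue measure. The observed data are held fixed. Since the observations are i.i.d. given $\boldsymbol{\theta}$, the joint likelihood factorizes as $p(\mathcal{D}|\boldsymbol{\theta})=\prod_{m=1}^{M}p(\mathcal{D}_m|\boldsymbol{\theta})$ for any split of $\mathcal{D}$ into mutually exclusive subsets $\mathcal{D}_1,\dots,\mathcal{D}_M$; in particular the function $\boldsymbol{\theta}\mapsto p(\mathcal{D}|\boldsymbol{\theta})$ does not depend on $M$ or on the split. Local posterior of agent $m$: $p(\boldsymbol{\theta}|\mathcal{D}_m)=p(\mathcal{D}_m|\boldsymbol{\theta})\,p(\boldsymbol{\theta})/p(\mathcal{D}_m)$, with $p(\mathcal{D}_m)=\int p(\mathcal{D}_m|\boldsymbol{\theta})p(\boldsymbol{\theta})\,d\boldsymbol{\theta}$. CIL (conditionally independent likelihoods) fusion rule, which is the exact posterior given all the data: $$p(\boldsymbol{\theta}|\mathcal{D})=Z\,\frac{\prod_{m=1}^{M}p(\boldsymbol{\theta}|\mathcal{D}_m)}{p^{M-1}(\boldsymbol{\theta})}=\frac{\prod_{m=1}^{M}p(\mathcal{D}_m|\boldsymbol{\theta})\,p(\boldsymbol{\theta})}{p(\mathcal{D})},\qquad p(\mathcal{D})=\int\prod_{m=1}^{M}p(\mathcal{D}_m|\boldsymbol{\theta})\,p(\boldsymbol{\theta})\,d\boldsymbol{\theta}.$$ CIP (conditionally independent posteriors) fusion rule for $M$ agents,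 the normalized product of the local posteriors: $$\widetilde p_M(\boldsymbol{\theta}|\mathcal{D})=\widetilde Z\prod_{m=1}^{M}p(\boldsymbol{\theta}|\mathcal{D}_m)=\frac{\prod_{m=1}^{M}p(\mathcal{D}_m|\boldsymbol{\theta})\,p^{M}(\boldsymbol{\theta})}{p_M(\mathcal{D})},\qquad p_M(\mathcal{D})=\int\prod_{m=1}^{M}p(\mathcal{D}_m|\boldsymbol{\theta})\,p^{M}(\boldsymbol{\theta})\,d\boldsymbol{\theta},$$ where $p^{M}(\boldsymbol{\theta})=(p(\boldsymbol{\theta}))^{M}$. It is assumed throughout that these densities are well defined, i.e. that the normalizing integrals $p(\mathcal{D}_m)$, $p(\mathcal{D})$ and $p_M(\mathcal{D})$ involved are finite and strictly positive. Divergences: for probability densities $f,g$ on $\mathbb{R}^{n_\theta}$, $$\mathrm{KL}(f\parallel g)=\int f\log\frac{f}{g}\,d\boldsymbol{\theta},\qquad \chi^2(f\parallel g)=\int\frac{(f-g)^2}{g}\,d\boldsymbol{\theta}=\int\frac{f^2}{g}\,d\boldsymbol{\theta}-1 .$$ The subscript $M$ in $d_M$ records the number of agents, which enters through $\widetilde p_M(\boldsymbol{\theta}|\mathcal{D})$. *)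

theory Defs
  imports "HOL-Probability.Probability"
begin

section \<open>Data, splits and local posteriors\<close>

text \<open>
  Observations are \<open>y i\<close> for \<open>i\<close> in a finite index set, and \<open>L v \<theta>\<close> is the
  likelihood \<open>p(v | \<theta>)\<close> of a single observation \<open>v\<close>.  Using one function \<open>L\<close> for all
  observations, and its product over a set of indices, expresses that they are i.i.d.
  given \<open>\<theta>\<close>.  A subset of the data is represented by its set of indices, so that
  repeated observed values are counted with multiplicity.
\<close>

definition lik :: "('y \<Rightarrow> 'a \<Rightarrow> real) \<Rightarrow> ('i \<Rightarrow> 'y) \<Rightarrow> 'i set \<Rightarrow> 'a \<Rightarrow> real" where
  "lik L y S \<theta> = (\<Prod>i\<in>S. L (y i) \<theta>)"

text \<open>Parts of a split may be empty; an agent without data has likelihood \<open>1\<close>.\<close>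

definition split_among :: "'i set \<Rightarrow> nat \<Rightarrow> (nat \<Rightarrow> 'i set) \<Rightarrow> bool" where
  "split_among I M A \<longleftrightarrow> (\<Union>m\<in>{1..M}. A m) = I \<and> disjoint_family_on A {1..M}"

definition prob_density :: "('a::euclidean_space \<Rightarrow> real) \<Rightarrow> bool" where
  "prob_density f \<longleftrightarrow>
     f \<in> borel_measurable borel \<and> (\<forall>x. 0 \<le> f x) \<and> (\<integral>\<^sup>+x. ennreal (f x) \<partial>lborel) = 1"

definition evidence ::
  "('y \<Rightarrow> 'a::euclidean_space \<Rightarrow> real) \<Rightarrow> ('i \<Rightarrow> 'y) \<Rightarrow> ('a \<Rightarrow> real) \<Rightarrow> 'i set \<Rightarrow> real" where
  "evidence L y p S = (\<integral>\<theta>. lik L y S \<theta> * p \<theta> \<partial>lborel)"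

definition local_posterior ::
  "('y \<Rightarrow> 'a::euclidean_space \<Rightarrow> real) \<Rightarrow> ('i \<Rightarrow> 'y) \<Rightarrow> ('a \<Rightarrow> real) \<Rightarrow> 'i set \<Rightarrow> 'a \<Rightarrow> real" where
  "local_posterior L y p S \<theta> = lik L y S \<theta> * p \<theta> / evidence L y p S"

section \<open>Fusion rules\<close>

definition normalized :: "('a::euclidean_space \<Rightarrow> real) \<Rightarrow> 'a \<Rightarrow> real" where
  "normalized f \<theta> = f \<theta> / (\<integral>x. f x \<partial>lborel)"

text \<open>
  Where the prior vanishes and \<open>M \<ge> 2\<close>, the quotient below is \<open>0 / 0 = 0\<close>, which is the
  value of the exact posterior there; see \<open>cil_fusion_eq\<close>.
\<close>

definition cil_fusion ::
  "('y \<Rightarrow> 'a::euclidean_space \<Rightarrow> real) \<Rightarrow> ('i \<Rightarrow> 'y) \<Rightarrow> ('a \<Rightarrow> real) \<Rightarrow> nat \<Rightarrow> (nat \<Rightarrow> 'i set)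
     \<Rightarrow> 'a \<Rightarrow> real" where
  "cil_fusion L y p M A =
     normalized (\<lambda>\<theta>. (\<Prod>m=1..M. local_posterior L y p (A m) \<theta>) / p \<theta> ^ (M - 1))"

definition cip_fusion ::
  "('y \<Rightarrow> 'a::euclidean_space \<Rightarrow> real) \<Rightarrow> ('i \<Rightarrow> 'y) \<Rightarrow> ('a \<Rightarrow> real) \<Rightarrow> nat \<Rightarrow> (nat \<Rightarrow> 'i set)
     \<Rightarrow> 'a \<Rightarrow> real" where
  "cip_fusion L y p M A = normalized (\<lambda>\<theta>. \<Prod>m=1..M. local_posterior L y p (A m) \<theta>)"

definition normalizable :: "('a::euclidean_space \<Rightarrow> real) \<Rightarrow> bool" where
  "normalizable f \<longleftrightarrow> integrable lborel f \<and> 0 < (\<integral>x. f x \<partial>lborel)"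

text \<open>The three conditions concern \<open>p(D\<^sub>m)\<close>, \<open>p(D)\<close> and \<open>p\<^sub>M(D)\<close>, in this order.\<close>

definition fusion_well_defined ::
  "('y \<Rightarrow> 'a::euclidean_space \<Rightarrow> real) \<Rightarrow> ('i \<Rightarrow> 'y) \<Rightarrow> ('a \<Rightarrow> real) \<Rightarrow> nat \<Rightarrow> (nat \<Rightarrow> 'i set)
     \<Rightarrow> bool" where
  "fusion_well_defined L y p M A \<longleftrightarrow>
     (\<forall>m\<in>{1..M}. normalizable (\<lambda>\<theta>. lik L y (A m) \<theta> * p \<theta>)) \<and>
     normalizable (\<lambda>\<theta>. (\<Prod>m=1..M. lik L y (A m) \<theta>) * p \<theta>) \<and>
     normalizable (\<lambda>\<theta>. (\<Prod>m=1..M. lik L y (A m) \<theta>) * p \<theta> ^ M)"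

lemma normalized_cdivide:
  assumes "c \<noteq> 0"
  shows "normalized (\<lambda>\<theta>. f \<theta> / c) = normalized f"
  using assms by (simp add: normalized_def fun_eq_iff)

lemma prod_local_posterior:
  "(\<Prod>m=1..M. local_posterior L y p (A m) \<theta>) =
     (\<Prod>m=1..M. lik L y (A m) \<theta>) * p \<theta> ^ M / (\<Prod>m=1..M. evidence L y p (A m))"
  by (simp add: local_posterior_def prod_dividef prod.distrib)

lemma prod_evidence_neq_0:
  assumes "fusion_well_defined L y p M A"
  shows "(\<Prod>m=1..M. evidence L y p (A m)) \<noteq> 0"
proof -
  have "evidence L y p (A m) > 0" if "m \<in> {1..M}" for m
    using assms that unfolding fusion_well_defined_def normalizable_def evidence_def by blast
  then show ?thesis
    by (force simp: prod_zero_iff)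
qed

lemma cip_fusion_eq:
  assumes "fusion_well_defined L y p M A"
  shows "cip_fusion L y p M A = normalized (\<lambda>\<theta>. (\<Prod>m=1..M. lik L y (A m) \<theta>) * p \<theta> ^ M)"
  unfolding cip_fusion_def prod_local_posterior
  by (rule normalized_cdivide[OF prod_evidence_neq_0[OF assms]])

lemma cil_fusion_eq:
  assumes "fusion_well_defined L y p M A" and "1 \<le> M"
  shows "cil_fusion L y p M A = normalized (\<lambda>\<theta>. (\<Prod>m=1..M. lik L y (A m) \<theta>) * p \<theta>)"
proof -
  have "p \<theta> ^ M / p \<theta> ^ (M - 1) = p \<theta>" for \<theta>
    using assms(2) by (cases M; cases "p \<theta> = 0") auto
  moreover have "a * b / c / d = a * (b / d) / c" for a b c d :: real
    by simp
  ultimately have "(\<Prod>m=1..M. local_posterior L y p (A m) \<theta>) / p \<theta> ^ (M - 1) =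
      (\<Prod>m=1..M. lik L y (A m) \<theta>) * p \<theta> / (\<Prod>m=1..M. evidence L y p (A m))" for \<theta>
    by (simp only: prod_local_posterior)
  then show ?thesis
    unfolding cil_fusion_def
    by (simp only: normalized_cdivide[OF prod_evidence_neq_0[OF assms(1)]])
qed

section \<open>Divergences with values in \<open>[0, \<infinity>]\<close>\<close>

text \<open>
  The library constant \<open>KL_divergence\<close> is real-valued and is \<open>0\<close> when the integral
  diverges, so it cannot be used where the value \<open>\<infinity>\<close> is meant.  The integrand follows
  the conventions \<open>0 log (0 / g) = 0\<close> and \<open>f log (f / 0) = \<infinity>\<close> for \<open>f > 0\<close>.  For
  probability densities the integral of the negative part is at most \<open>1\<close>, because
  \<open>f log (f / g) \<ge> f - g\<close>, so the difference below is never \<open>\<infinity> - \<infinity>\<close>.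
\<close>

definition kl_integrand :: "('a \<Rightarrow> real) \<Rightarrow> ('a \<Rightarrow> real) \<Rightarrow> 'a \<Rightarrow> ereal" where
  "kl_integrand f g x =
     (if f x = 0 then 0 else if g x = 0 then \<infinity> else ereal (f x * ln (f x / g x)))"

definition KL_div :: "('a::euclidean_space \<Rightarrow> real) \<Rightarrow> ('a \<Rightarrow> real) \<Rightarrow> ereal" where
  "KL_div f g =
     enn2ereal (\<integral>\<^sup>+x. e2ennreal (kl_integrand f g x) \<partial>lborel) -
     enn2ereal (\<integral>\<^sup>+x. e2ennreal (- kl_integrand f g x) \<partial>lborel)"

definition chi2_div :: "('a::euclidean_space \<Rightarrow> real) \<Rightarrow> ('a \<Rightarrow> real) \<Rightarrow> ennreal" where
  "chi2_div f g =
     (\<integral>\<^sup>+x. (if g x = 0 then (if f x = 0 then 0 else \<infinity>)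
             else ennreal ((f x - g x)\<^sup>2 / g x)) \<partial>lborel)"

lemma KL_div_eq_integral:
  assumes "integrable lborel (\<lambda>x. f x * ln (f x / g x))"
    and "\<And>x. g x = 0 \<Longrightarrow> f x = 0"
  shows "KL_div f g = ereal (\<integral>x. f x * ln (f x / g x) \<partial>lborel)"
proof -
  let ?h = "\<lambda>x. f x * ln (f x / g x)"
  have h: "kl_integrand f g x = ereal (?h x)" for x
    using assms(2) by (auto simp: kl_integrand_def)
  have e: "e2ennreal (ereal r) = ennreal r" for r
    by (simp add: ennreal.abs_eq)
  from integrableE[OF assms(1)] obtain r q where rq: "0 \<le> r" "0 \<le> q"
    "(\<integral>\<^sup>+x. ennreal (?h x) \<partial>lborel) = ennreal r"
    "(\<integral>\<^sup>+x. ennreal (- ?h x) \<partial>lborel) = ennreal q"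
    "integral\<^sup>L lborel ?h = r - q"
    by blast
  show ?thesis
    unfolding KL_div_def h by (simp only: e uminus_ereal.simps rq) (simp add: rq enn2ereal_ennreal)
qed

end

theory Submission
  imports Defs
begin

text \<open>
  Write \<open>w\<close> for the joint likelihood, so that the exact posterior is \<open>f \<propto> w p\<close> and the fused
  one is \<open>g\<^sub>M = w p\<^sup>M / c\<^sub>M\<close>.  With \<open>t = c\<^bsub>M+1\<^esub> / c\<^sub>M\<close> one has \<open>g\<^sub>M / g\<^bsub>M+1\<^esub> = t / p\<close>, and
  integrating \<open>w p (p - t) (p\<^bsup>M-1\<^esup> - t\<^bsup>M-1\<^esup>) \<ge> 0\<close> shows that the mean of \<open>p\<close> under \<open>f\<close> is at
  most \<open>t\<close>.  Passing from \<open>M\<close> to \<open>M + 1\<close> increases either divergence by the integral of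
  some function that is at least \<open>K f (t - p)\<close> for a constant \<open>K \<ge> 0\<close>, up to a term of
  integral \<open>0\<close>: for KL the bound is \<open>ln (t / p) \<ge> 1 - p / t\<close>, for \<open>\<chi>\<^sup>2\<close> it is
  \<open>(p\<^bsup>-M\<^esup> - t\<^bsup>-M\<^esup>) (t - p) \<ge> 0\<close>.
\<close>

section \<open>Inequalities for powers and for possibly infinite integrals\<close>

lemma diff_mult_diff_power_nonneg:
  fixes a b :: real
  assumes "0 \<le> a" "0 \<le> b"
  shows "0 \<le> (a - b) * (a ^ n - b ^ n)"
proof (cases "a \<le> b")
  case True
  then show ?thesis using assms by (intro mult_nonpos_nonpos) (simp_all add: power_mono)
next
  case False
  then show ?thesis using assms by (intro mult_nonneg_nonneg) (simp_all add: power_mono)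
qed

text \<open>Monotonicity of the integral where both sides may be infinite. The integrable minorant
  \<open>s + r\<close> of \<open>b\<close> keeps the negative part of \<open>b\<close> finite. If
  its positive part is infinite, the right side is infinite; otherwise \<open>b\<close> is
  integrable and the usual comparison applies.\<close>

lemma nn_integral_pos_minus_neg_mono:
  fixes a b r s :: "'a \<Rightarrow> real"
  assumes meas: "a \<in> borel_measurable N" "b \<in> borel_measurable N"
    and s: "integrable N s" "\<And>x. s x \<le> a x"
    and r: "integrable N r" "0 \<le> (\<integral>x. r x \<partial>N)" "\<And>x. a x + r x \<le> b x"
  shows "enn2ereal (\<integral>\<^sup>+x. ennreal (a x) \<partial>N) - enn2ereal (\<integral>\<^sup>+x. ennreal (- a x) \<partial>N)
       \<le> enn2ereal (\<integral>\<^sup>+x. ennreal (b x) \<partial>N) - enn2ereal (\<integral>\<^sup>+x. ennreal (- b x) \<partial>N)"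
proof -
  have signed: "enn2ereal (\<integral>\<^sup>+x. ennreal (h x) \<partial>N) - enn2ereal (\<integral>\<^sup>+x. ennreal (- h x) \<partial>N)
      = ereal (\<integral>x. h x \<partial>N)" if "integrable N h" for h :: "'a \<Rightarrow> real"
    using integrableE[OF that] by (metis enn2ereal_ennreal ereal_minus(1))
  have sr: "integrable N (\<lambda>x. s x + r x)"
    using s(1) r(1) by simp
  have "(\<integral>\<^sup>+x. ennreal (- b x) \<partial>N) \<le> (\<integral>\<^sup>+x. ennreal (- (s x + r x)) \<partial>N)"
    using s(2) r(3) by (intro nn_integral_mono ennreal_leI) (smt (verit))
  also have "\<dots> < \<infinity>"
    using sr by (auto simp: real_integrable_def less_top)
  finally have negb: "(\<integral>\<^sup>+x. ennreal (- b x) \<partial>N) < \<infinity>" .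
  show ?thesis
  proof (cases "(\<integral>\<^sup>+x. ennreal (b x) \<partial>N) = \<infinity>")
    case True
    have "enn2ereal (\<integral>\<^sup>+x. ennreal (- b x) \<partial>N) \<noteq> \<infinity>"
      using negb by (simp add: enn2ereal_eq_top_iff flip: infinity_ereal_def)
    then show ?thesis
      using True by simp
  next
    case False
    then have b: "integrable N b"
      using negb meas by (auto simp: real_integrable_def)
    \<comment> \<open>\<open>a\<close> is squeezed between the integrable functions \<open>s\<close>
      and \<open>b - r\<close>.\<close>
    have "integrable N (\<lambda>x. \<bar>s x\<bar> + \<bar>b x - r x\<bar>)"
      using s(1) r(1) b by simp
    then have a: "integrable N a"
    proof (rule Bochner_Integration.integrable_bound[OF _ meas(1)])
      have "\<bar>a x\<bar> \<le> \<bar>s x\<bar> + \<bar>b x - r x\<bar>" for x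
        using s(2)[of x] r(3)[of x] by linarith
      then show "AE x in N. norm (a x) \<le> norm (\<bar>s x\<bar> + \<bar>b x - r x\<bar>)"
        by simp
    qed
    have "(\<integral>x. a x \<partial>N) \<le> (\<integral>x. a x + r x \<partial>N)"
      using a r by simp
    also have "\<dots> \<le> (\<integral>x. b x \<partial>N)"
      using a b r by (intro integral_mono) auto
    finally show ?thesis
      by (simp add: signed a b)
  qed
qed

text \<open>By disjointness each index is counted exactly once, so the joint likelihood is the same
  for every split and for every number of agents.\<close>

lemma lik_split:
  assumes "finite I" "split_among I M A"
  shows "(\<Prod>m=1..M. lik L y (A m) \<theta>) = lik L y I \<theta>"
proof -
  have "lik L y (\<Union>m\<in>{1..M}. A m) \<theta> = (\<Prod>m=1..M. lik L y (A m) \<theta>)"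
    unfolding lik_def
  proof (rule prod.UNION_disjoint)
    show "\<forall>m\<in>{1..M}. finite (A m)"
      using assms unfolding split_among_def by (metis UN_upper finite_subset)
    show "\<forall>i\<in>{1..M}. \<forall>j\<in>{1..M}. i \<noteq> j \<longrightarrow> A i \<inter> A j = {}"
      using assms unfolding split_among_def disjoint_family_on_def by blast
  qed simp
  then show ?thesis
    using assms by (simp add: split_among_def)
qed

text \<open>Under absolute continuity the integrand is real-valued, which brings the divergence into
  the form of \<open>nn_integral_pos_minus_neg_mono\<close> while still allowing the value
  infinity.\<close>

lemma KL_div_eq_signed:
  assumes "\<forall>x. g x = 0 \<longrightarrow> f x = 0"
  shows "KL_div f g =
    enn2ereal (\<integral>\<^sup>+x. ennreal (f x * ln (f x / g x)) \<partial>lborel) -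
    enn2ereal (\<integral>\<^sup>+x. ennreal (- (f x * ln (f x / g x))) \<partial>lborel)"
proof -
  have "kl_integrand f g x = ereal (f x * ln (f x / g x))" for x
    using assms by (auto simp: kl_integrand_def)
  moreover have "e2ennreal (ereal r) = ennreal r" for r
    by (simp add: ennreal.abs_eq)
  ultimately show ?thesis
    unfolding KL_div_def by (simp only: uminus_ereal.simps)
qed

lemma chi2_div_eq:
  assumes "\<forall>x. g x = 0 \<longrightarrow> f x = 0"
  shows "chi2_div f g = (\<integral>\<^sup>+x. ennreal ((f x - g x)\<^sup>2 / g x) \<partial>lborel)"
  unfolding chi2_div_def using assms by (intro nn_integral_cong) auto

text \<open>The problem with the data abstracted away: \<open>w\<close> is the joint likelihood,
  \<open>f\<close> the exact posterior, and \<open>g\<close> and \<open>g'\<close> the fused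
  posteriors for \<open>M\<close> and \<open>M + 1\<close> agents.\<close>

locale tilted_densities =
  fixes w p :: "'a::euclidean_space \<Rightarrow> real" and M :: nat
  assumes w_meas [measurable]: "w \<in> borel_measurable borel" and w_nonneg: "0 \<le> w x"
    and p_meas [measurable]: "p \<in> borel_measurable borel" and p_nonneg: "0 \<le> p x"
    and M_pos: "1 \<le> M"
    and norm_1: "normalizable (\<lambda>x. w x * p x)"
    and norm_M: "normalizable (\<lambda>x. w x * p x ^ M)"
    and norm_Suc: "normalizable (\<lambda>x. w x * p x ^ (M + 1))"
begin

definition "Z = (\<integral>x. w x * p x \<partial>lborel)"
definition "c = (\<integral>x. w x * p x ^ M \<partial>lborel)"
definition "c' = (\<integral>x. w x * p x ^ (M + 1) \<partial>lborel)"
definition "t = c' / c"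

definition "f = normalized (\<lambda>x. w x * p x)"
definition "g = normalized (\<lambda>x. w x * p x ^ M)"
definition "g' = normalized (\<lambda>x. w x * p x ^ (M + 1))"

lemma f_eq: "f x = w x * p x / Z"
  and g_eq: "g x = w x * p x ^ M / c"
  and g'_eq: "g' x = w x * p x ^ (M + 1) / c'"
  by (simp_all add: f_def g_def g'_def normalized_def Z_def c_def c'_def)

section \<open>Moments and the mean of \<open>p\<close> under \<open>f\<close>\<close>

lemma consts_pos: "0 < Z" "0 < c" "0 < c'" "0 < t"
  using norm_1 norm_M norm_Suc by (simp_all add: normalizable_def Z_def c_def c'_def t_def)

lemma int_wp: "integrable lborel (\<lambda>x. w x * p x)"
  and int_wpM: "integrable lborel (\<lambda>x. w x * p x ^ M)"
  and int_wpM1: "integrable lborel (\<lambda>x. w x * p x ^ (M + 1))"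
  using norm_1 norm_M norm_Suc unfolding normalizable_def by blast+

lemma int_f: "integrable lborel f" "(\<integral>x. f x \<partial>lborel) = 1"
  and int_g: "integrable lborel g" "(\<integral>x. g x \<partial>lborel) = 1"
  and int_g': "integrable lborel g'" "(\<integral>x. g' x \<partial>lborel) = 1"
  unfolding f_eq[abs_def] g_eq[abs_def] g'_eq[abs_def]
  using int_wp int_wpM int_wpM1 consts_pos by (simp_all add: Z_def c_def c'_def)

text \<open>The exponent 2 lies between 1 and \<open>M + 1\<close>, so \<open>p^2\<close> is at most
  \<open>p\<close> where \<open>p \<le> 1\<close> and at most \<open>p^(M+1)\<close> elsewhere. This
  makes the mean of \<open>p\<close> under \<open>f\<close> finite.\<close>

lemma int_wp2: "integrable lborel (\<lambda>x. w x * (p x)\<^sup>2)"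
proof (rule Bochner_Integration.integrable_bound)
  show "integrable lborel (\<lambda>x. w x * p x + w x * p x ^ (M + 1))"
    using int_wp int_wpM1 by (rule Bochner_Integration.integrable_add)
  have "w x * (p x)\<^sup>2 \<le> w x * p x + w x * p x ^ (M + 1)" for x
  proof -
    have "(p x)\<^sup>2 \<le> p x + p x ^ (M + 1)"
    proof (cases "p x \<le> 1")
      case True
      have "(p x)\<^sup>2 \<le> p x ^ 1"
        using True p_nonneg[of x] by (intro power_decreasing) auto
      then show ?thesis using p_nonneg[of x] by (simp add: add_increasing2)
    next
      case False
      then have "(p x)\<^sup>2 \<le> p x ^ (M + 1)"
        using M_pos by (intro power_increasing) auto
      then show ?thesis using p_nonneg[of x] by simp
    qed
    from mult_left_mono[OF this w_nonneg[of x]] show ?thesis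
      by (simp add: distrib_left)
  qed
  then show "AE x in lborel. norm (w x * (p x)\<^sup>2) \<le> norm (w x * p x + w x * p x ^ (M + 1))"
    using w_nonneg p_nonneg by (auto simp: abs_mult)
qed simp

lemma int_wp_diff: "integrable lborel (\<lambda>x. w x * p x * (t - p x))"
proof -
  have "integrable lborel (\<lambda>x. t * (w x * p x) - w x * (p x)\<^sup>2)"
    using int_wp int_wp2 by simp
  then show ?thesis
    by (simp add: algebra_simps power2_eq_square)
qed

lemma integral_wp_diff_nonneg: "0 \<le> (\<integral>x. w x * p x * (t - p x) \<partial>lborel)"
proof -
  let ?k = "t ^ (M - 1)"
  have eq: "w x * p x * ((p x - t) * (p x ^ (M - 1) - ?k))
      = w x * p x ^ (M + 1) - t * (w x * p x ^ M) + ?k * (w x * p x * (t - p x))" for x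
    using M_pos by (cases M) (simp_all add: algebra_simps)
  have "0 \<le> (\<integral>x. w x * p x * ((p x - t) * (p x ^ (M - 1) - ?k)) \<partial>lborel)"
    using w_nonneg p_nonneg consts_pos
    by (intro integral_nonneg_AE AE_I2 mult_nonneg_nonneg[OF _ diff_mult_diff_power_nonneg]) auto
  also have "\<dots> = c' - t * c + ?k * (\<integral>x. w x * p x * (t - p x) \<partial>lborel)"
    unfolding eq using int_wpM int_wpM1 int_wp_diff by (simp add: c_def c'_def)
  \<comment> \<open>This cancellation is the reason for the choice of \<open>t\<close>; only the
    positive multiple \<open>?k\<close> of the wanted integral remains.\<close>
  also have "c' - t * c = 0"
    using consts_pos by (simp add: t_def)
  finally show ?thesis
    using consts_pos zero_less_power[of t "M - 1"] by (simp add: zero_le_mult_iff del: zero_less_power)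
qed

lemma int_f_diff: "integrable lborel (\<lambda>x. f x * (t - p x))"
  and integral_f_diff_nonneg: "0 \<le> (\<integral>x. f x * (t - p x) \<partial>lborel)"
  using int_wp_diff integral_wp_diff_nonneg consts_pos by (simp_all add: f_eq)

text \<open>Case rule for the pointwise estimates: in the first case all divergence integrands are 0
  because division by zero yields 0, in the second logarithms and quotients can be manipulated
  freely.\<close>

lemma f_zero_or_pos:
  obtains (zero) "f x = 0" "g x = 0" "g' x = 0" | (pos) "0 < w x" "0 < p x"
proof (cases "w x = 0 \<or> p x = 0")
  case True
  then show ?thesis using zero M_pos by (auto simp: f_eq g_eq g'_eq)
next
  case False
  then show ?thesis using pos w_nonneg[of x] p_nonneg[of x] by (simp add: order_less_le)
qed

lemma g_zero: "\<forall>x. g x = 0 \<longrightarrow> f x = 0"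
  and g'_zero: "\<forall>x. g' x = 0 \<longrightarrow> f x = 0"
  using consts_pos by (auto simp: f_eq g_eq g'_eq)

lemma measurable_fg [measurable]:
  "f \<in> borel_measurable borel" "g \<in> borel_measurable borel" "g' \<in> borel_measurable borel"
  by (simp_all add: f_eq[abs_def] g_eq[abs_def] g'_eq[abs_def])

section \<open>Monotonicity of the two divergences\<close>

lemma KL_div_mono: "KL_div f g \<le> KL_div f g'"
  unfolding KL_div_eq_signed[OF g_zero] KL_div_eq_signed[OF g'_zero]
proof (rule nn_integral_pos_minus_neg_mono)
  \<comment> \<open>The minorant comes from \<open>ln u \<le> u - 1\<close> at
    \<open>u = g / f\<close>.\<close>
  show "integrable lborel (\<lambda>x. f x - g x)"
    using int_f int_g by simp
  show "f x - g x \<le> f x * ln (f x / g x)" for x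
  proof (cases x rule: f_zero_or_pos)
    case pos
    then have p: "0 < f x" "0 < g x"
      using consts_pos by (simp_all add: f_eq g_eq)
    then have "1 - g x / f x \<le> ln (f x / g x)"
      using ln_le_minus_one[of "g x / f x"] by (simp add: ln_div)
    from mult_left_mono[OF this, of "f x"] p show ?thesis
      by (simp add: right_diff_distrib)
  qed simp
  show "integrable lborel (\<lambda>x. 1 / t * (f x * (t - p x)))"
    using int_f_diff by simp
  show "0 \<le> (\<integral>x. 1 / t * (f x * (t - p x)) \<partial>lborel)"
    using integral_f_diff_nonneg consts_pos by simp
  show "f x * ln (f x / g x) + 1 / t * (f x * (t - p x)) \<le> f x * ln (f x / g' x)" for x
  proof (cases x rule: f_zero_or_pos)
    case pos
    then have p: "0 < f x" "0 < g x" "0 < g' x"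
      using consts_pos by (simp_all add: f_eq g_eq g'_eq)
    have "f x / g' x = f x / g x * (t / p x)"
      using pos consts_pos by (simp add: g_eq g'_eq t_def field_simps)
    then have "ln (f x / g' x) = ln (f x / g x) + ln (t / p x)"
      using pos p consts_pos by (simp add: ln_mult ln_div)
    \<comment> \<open>The same inequality at \<open>u = p / t\<close> makes the gain linear in
      \<open>p\<close>, so that the bound on the mean applies.\<close>
    moreover have "1 - p x / t \<le> ln (t / p x)"
      using ln_le_minus_one[of "p x / t"] pos consts_pos by (simp add: ln_div)
    ultimately have "ln (f x / g x) + 1 / t * (t - p x) \<le> ln (f x / g' x)"
      using consts_pos by (simp add: diff_divide_distrib)
    from mult_left_mono[OF this, of "f x"] p show ?thesis
      by (simp add: algebra_simps)
  qed simp
qed measurable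

lemma chi2_div_mono: "chi2_div f g \<le> chi2_div f g'"
proof -
  \<comment> \<open>The increase \<open>f / g' - f / g\<close> equals
    \<open>c / (Z * p^M) * (t - p)\<close>; \<open>K\<close> is its coefficient with
    \<open>p\<close> replaced by \<open>t\<close>.\<close>
  define K where "K = c / (Z * t ^ M)"
  have K: "0 \<le> K" using consts_pos by (simp add: K_def)
  let ?a = "\<lambda>x. (f x - g x)\<^sup>2 / g x" and ?b = "\<lambda>x. (f x - g' x)\<^sup>2 / g' x"
  have g_nonneg: "0 \<le> g x" "0 \<le> g' x" for x
    using w_nonneg p_nonneg consts_pos by (simp_all add: g_eq g'_eq)
  \<comment> \<open>Vanishing negative parts are subtracted so that the comparison lemma applies,
    with minorant 0.\<close>
  have "enn2ereal (\<integral>\<^sup>+x. ennreal (?a x) \<partial>lborel) - enn2ereal (\<integral>\<^sup>+x. ennreal (- ?a x) \<partial>lborel)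
      \<le> enn2ereal (\<integral>\<^sup>+x. ennreal (?b x) \<partial>lborel) - enn2ereal (\<integral>\<^sup>+x. ennreal (- ?b x) \<partial>lborel)"
  proof (rule nn_integral_pos_minus_neg_mono)
    show "integrable lborel (\<lambda>x. 0 :: real)" by simp
    show "0 \<le> ?a x" for x using g_nonneg by simp
    show "integrable lborel (\<lambda>x. K * (f x * (t - p x)) + (g' x - g x))"
      using int_f_diff int_g int_g' by simp
    show "0 \<le> (\<integral>x. K * (f x * (t - p x)) + (g' x - g x) \<partial>lborel)"
      using int_f_diff int_g int_g' integral_f_diff_nonneg K by simp
    show "?a x + (K * (f x * (t - p x)) + (g' x - g x)) \<le> ?b x" for x
    proof (cases x rule: f_zero_or_pos)
      case pos
      then have p: "0 < f x" "0 < g x" "0 < g' x"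
        using consts_pos by (simp_all add: f_eq g_eq g'_eq)
      \<comment> \<open>Between \<open>v = g\<close> and \<open>v = g'\<close> the term
        \<open>2 * u\<close> cancels, and the last term leaves \<open>g' - g\<close>, whose integral
        is 0.\<close>
      have sq: "(u - v)\<^sup>2 / v = u * (u / v) - 2 * u + v" if "0 < v" for u v :: real
        using that by (simp add: field_simps power2_eq_square)
      have "0 \<le> (p x - t) * (p x ^ M - t ^ M)"
        using pos consts_pos by (intro diff_mult_diff_power_nonneg) auto
      then have "0 \<le> c / (Z * p x ^ M * t ^ M) * ((p x - t) * (p x ^ M - t ^ M))"
        using pos consts_pos by simp
      also have "\<dots> = (c / (Z * p x ^ M) - K) * (t - p x)"
        using pos consts_pos by (simp add: K_def field_simps)
      also have "c / (Z * p x ^ M) * t = f x / g' x"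
        using pos consts_pos by (simp add: f_eq g'_eq t_def field_simps)
      then have "(c / (Z * p x ^ M) - K) * (t - p x)
          = f x / g' x - f x / g x - K * (t - p x)"
        using pos consts_pos by (simp add: f_eq g_eq left_diff_distrib right_diff_distrib)
      finally have "f x / g x + K * (t - p x) \<le> f x / g' x"
        by simp
      from mult_left_mono[OF this, of "f x"] p show ?thesis
        by (simp add: sq algebra_simps)
    qed simp
  qed measurable
  moreover have "ennreal (- ?a x) = 0" "ennreal (- ?b x) = 0" for x
    using g_nonneg by (simp_all add: ennreal_neg)
  ultimately show ?thesis
    unfolding chi2_div_eq[OF g_zero] chi2_div_eq[OF g'_zero]
    by (simp add: less_eq_ennreal.rep_eq zero_ennreal.rep_eq)
qed

end

section \<open>Application to the fusion rules\<close>

theorem theorem2: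
  fixes I :: "'i set"
    and y :: "'i \<Rightarrow> 'y"
    and L :: "'y \<Rightarrow> real ^ 'n \<Rightarrow> real"
    and p :: "real ^ 'n \<Rightarrow> real"
    and M :: nat
    and A B :: "nat \<Rightarrow> 'i set"
  assumes "finite I"
    and "\<And>i. i \<in> I \<Longrightarrow> L (y i) \<in> borel_measurable borel"
    and "\<And>i \<theta>. i \<in> I \<Longrightarrow> 0 \<le> L (y i) \<theta>"
    and "prob_density p"
    and "1 \<le> M"
    and "split_among I M A"
    and "split_among I (M + 1) B"
    and "fusion_well_defined L y p M A"
    and "fusion_well_defined L y p (M + 1) B"
  shows "KL_div (cil_fusion L y p (M + 1) B) (cip_fusion L y p (M + 1) B)
           \<ge> KL_div (cil_fusion L y p M A) (cip_fusion L y p M A)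
       \<and> chi2_div (cil_fusion L y p (M + 1) B) (cip_fusion L y p (M + 1) B)
           \<ge> chi2_div (cil_fusion L y p M A) (cip_fusion L y p M A)"
proof -
  \<comment> \<open>Both splits yield the same \<open>w\<close>, so a single interpretation serves
    \<open>M\<close> and \<open>M + 1\<close> agents, with the same exact posterior
    \<open>f\<close>.\<close>
  note A = lik_split[OF assms(1,6)] and B = lik_split[OF assms(1,7)]
  interpret tilted_densities "lik L y I" p M
  proof
    show "lik L y I \<in> borel_measurable borel"
      unfolding lik_def[abs_def] using assms(2) by (rule borel_measurable_prod)
    show "0 \<le> lik L y I x" for x
      unfolding lik_def using assms(3) by (rule prod_nonneg)
    show "p \<in> borel_measurable borel" "0 \<le> p x" for x
      using assms(4) by (simp_all add: prob_density_def)
    show "1 \<le> M" by fact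
    show "normalizable (\<lambda>x. lik L y I x * p x)" "normalizable (\<lambda>x. lik L y I x * p x ^ M)"
      using assms(8) unfolding fusion_well_defined_def A by blast+
    show "normalizable (\<lambda>x. lik L y I x * p x ^ (M + 1))"
      using assms(9) unfolding fusion_well_defined_def B by blast
  qed
  have "1 \<le> M + 1" by simp
  from KL_div_mono chi2_div_mono show ?thesis
    unfolding f_def g_def g'_def
    unfolding cil_fusion_eq[OF assms(8,5)] cil_fusion_eq[OF assms(9) \<open>1 \<le> M + 1\<close>]
      cip_fusion_eq[OF assms(8)] cip_fusion_eq[OF assms(9)] A B by blast
qed

end
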